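(* Let $A\in\mathbb{R}^{m\times n}$ have nonzero columns, $y\in\mathbb{R}^m$, $1\le k\le n$. For $\alpha\ge0$ let $\rho^*_\alpha$ be the optimal value of the sparse ridge regression problem $$\min_{x\in\mathbb{R}^n}\tfrac1m\|Ax-y\|_2^2+\alpha\|x\|_2^2\quad\text{s.t. }\|x\|_0\le k,$$ and let $\bar\rho^*_\alpha$ be the optimal value of the semidefinite relaxation (Q-sridge). Let $x_0^*$ be an optimal solution of the sparse problem with $\alpha=0$ and $r_0^*=\frac1m\|y-Ax_0^*\|^2$. Put $\tau=1+(k-1)\mu(\bar A)$ and, whenever $\lambda_{\min}(A^TA)+m\alpha>0$, $\eta_\alpha=\frac{L^2}{\lambda_{\min}(A^TA)+m\alpha}$. Then for every such $\alpha$, $$(1-\tau\eta_\alpha)\frac{\|y\|^2}{m}+\tau\eta_\alpha r_0^*\le\bar\rho^*_\alpha\le\rho^*_\alpha.$$ Furthermore, if $$\bar\alpha=\frac{\tau}{m}L^2-\frac1m\lambda_{\min}(A^TA),$$ which implies $\tau\eta_{\bar\alpha}=1$, then $$0\le\rho^*_{\bar\alpha}-\bar\rho^*_{\bar\alpha}\le\tau\cdot\frac{L^2}{m}\|x_0^*\|^2\le k\cdot\frac{L^2}{m}\|x_0^*\|^2.$$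
   Context: $\mathbb{S}^n$ is the space of real symmetric $n\times n$ matrices, $A\bullet B=\operatorname{Tr}(B^TA)$, $A\succeq B$ means $A-B$ is positive semidefinite, $\operatorname{diag}(X)$ is the diagonal matrix with the same diagonal as $X$, $\|x\|_0$ is the number of nonzero entries, $\|\cdot\|$ is the Euclidean norm. $\mathcal{S}_{n,k}=\{X\in\mathbb{S}^n: k\operatorname{diag}(X)\succeq X\succeq 0\}$. The relaxation (Q-sridge) is $$\min_{\boldsymbol X\in\mathbb{S}^{n+1}} C_\alpha\bullet\boldsymbol X\quad\text{s.t. } X\in\mathcal{S}_{n,k},\quad \boldsymbol X=\begin{pmatrix} 1 & x^T \\ x & X \end{pmatrix}\succeq0,$$ where $C_\alpha=\frac1m\begin{pmatrix} y & -A \end{pmatrix}^T\begin{pmatrix} y & -A \end{pmatrix}+\alpha\begin{pmatrix} 0 & 0 \\ 0 & I_n \end{pmatrix}$. $\bar A$ is the matrix obtained from $A$ by normalizing each column to unit Euclidean norm; $L$ is the largest Euclidean norm of a column of $A$; for a matrix with unit-norm columns $a_1,\dots,a_n$ the coherence is $\mu=\max_{i\ne j}|\langle a_i,a_j\rangle|$. $\lambda_{\min}$ denotes the smallest eigenvalue. *)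

theory Defs
  imports "HOL-Analysis.Analysis"
begin

definition symmetric_mat :: "real^'n^'n \<Rightarrow> bool" where
  "symmetric_mat M \<longleftrightarrow> transpose M = M"

definition psd :: "real^'n^'n \<Rightarrow> bool" where
  "psd M \<longleftrightarrow> symmetric_mat M \<and> (\<forall>v. 0 \<le> v \<bullet> (M *v v))"

definition loewner_ge :: "real^'n^'n \<Rightarrow> real^'n^'n \<Rightarrow> bool"  (infix "\<succeq>" 50) where
  "M \<succeq> N \<longleftrightarrow> psd (M - N)"

definition mat_inner :: "real^'n^'m \<Rightarrow> real^'n^'m \<Rightarrow> real" where
  "mat_inner M N = trace (transpose N ** M)"

definition diag_mat :: "real^'n^'n \<Rightarrow> real^'n^'n" where
  "diag_mat M = (\<chi> i j. if i = j then M $ i $ j else 0)"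

definition eigenvalue :: "real^'n^'n \<Rightarrow> real \<Rightarrow> bool" where
  "eigenvalue M l \<longleftrightarrow> (\<exists>v. v \<noteq> 0 \<and> M *v v = l *\<^sub>R v)"

text \<open>Meant for symmetric matrices, whose set of real eigenvalues is finite and nonempty.\<close>

definition lambda_min :: "real^'n^'n \<Rightarrow> real" where
  "lambda_min M = Min {l. eigenvalue M l}"

definition l0_norm :: "real^'n \<Rightarrow> nat" where
  "l0_norm x = card {i. x $ i \<noteq> 0}"

definition normalize_columns :: "real^'n^'m \<Rightarrow> real^'n^'m" where
  "normalize_columns A = (\<chi> i j. A $ i $ j / norm (column j A))"

definition max_column_norm :: "real^'n^'m \<Rightarrow> real" where
  "max_column_norm A = Max (norm ` columns A)"

text \<open>With a single column the maximum is over the empty set and the value is unspecified;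
  it is then only ever multiplied by \<open>k - 1 = 0\<close>.\<close>

definition coherence :: "real^'n^'m \<Rightarrow> real" where
  "coherence A = Max {\<bar>column i A \<bullet> column j A\<bar> | i j. i \<noteq> j}"

text \<open>Matrices of order \<open>n + 1\<close> are indexed by \<open>'n option\<close>: \<open>None\<close> is the extra leading index.
  \<open>bordered c v M\<close> is the block matrix with rows \<open>(c, v\<^sup>T)\<close> and \<open>(v, M)\<close>.\<close>

definition bordered :: "real \<Rightarrow> real^'n \<Rightarrow> real^'n^'n \<Rightarrow> real^('n option)^('n option)" where
  "bordered c v M = (\<chi> i j. case (i, j) of
      (None, None) \<Rightarrow> c
    | (None, Some q) \<Rightarrow> v $ q
    | (Some p, None) \<Rightarrow> v $ p
    | (Some p, Some q) \<Rightarrow> M $ p $ q)"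

text \<open>The \<open>m \<times> (n + 1)\<close> matrix \<open>(y  -A)\<close>.\<close>

definition data_mat :: "real^'n^'m \<Rightarrow> real^'m \<Rightarrow> real^('n option)^'m" where
  "data_mat A y = (\<chi> i j. case j of None \<Rightarrow> y $ i | Some q \<Rightarrow> - A $ i $ q)"

definition cost_mat :: "real^'n^'m \<Rightarrow> real^'m \<Rightarrow> real \<Rightarrow> real^('n option)^('n option)" where
  "cost_mat A y \<alpha> =
     (1 / real CARD('m)) *\<^sub>R (transpose (data_mat A y) ** data_mat A y)
       + \<alpha> *\<^sub>R bordered 0 0 (mat 1)"

definition S_nk :: "nat \<Rightarrow> (real^'n^'n) set" where
  "S_nk k = {X. symmetric_mat X \<and> real k *\<^sub>R diag_mat X \<succeq> X \<and> X \<succeq> 0}"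

definition ridge_obj :: "real^'n^'m \<Rightarrow> real^'m \<Rightarrow> real \<Rightarrow> real^'n \<Rightarrow> real" where
  "ridge_obj A y \<alpha> x = 1 / real CARD('m) * (norm (A *v x - y))\<^sup>2 + \<alpha> * (norm x)\<^sup>2"

text \<open>For \<open>\<alpha> \<ge> 0\<close> both problems below are feasible with objective bounded below by \<open>0\<close>,
  so the infima are genuine optimal values.\<close>

definition rho :: "real^'n^'m \<Rightarrow> real^'m \<Rightarrow> nat \<Rightarrow> real \<Rightarrow> real" where
  "rho A y k \<alpha> = Inf {ridge_obj A y \<alpha> x | x. l0_norm x \<le> k}"

definition Q_feasible :: "nat \<Rightarrow> (real^('n::finite option)^('n option)) set" where
  "Q_feasible k = {Z. \<exists>x X. X \<in> S_nk k \<and> Z = bordered 1 x X \<and> Z \<succeq> 0}"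

definition rho_bar :: "real^'n^'m \<Rightarrow> real^'m \<Rightarrow> nat \<Rightarrow> real \<Rightarrow> real" where
  "rho_bar A y k \<alpha> = Inf {mat_inner (cost_mat A y \<alpha>) Z | Z. Z \<in> Q_feasible k}"

definition tau :: "real^'n^'m \<Rightarrow> nat \<Rightarrow> real" where
  "tau A k = 1 + (real k - 1) * coherence (normalize_columns A)"

text \<open>Only meaningful when the denominator is positive.\<close>

definition eta :: "real^'n^'m \<Rightarrow> real \<Rightarrow> real" where
  "eta A \<alpha> = (max_column_norm A)\<^sup>2
     / (lambda_min (transpose A ** A) + real CARD('m) * \<alpha>)"

definition alpha_bar :: "real^'n^'m \<Rightarrow> nat \<Rightarrow> real" where
  "alpha_bar A k = tau A k / real CARD('m) * (max_column_norm A)\<^sup>2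
     - 1 / real CARD('m) * lambda_min (transpose A ** A)"

end

theory Submission
  imports Defs
begin

text \<open>
  Let \<open>\<lambda>\<close> be the smallest eigenvalue of \<open>A\<^sup>T A\<close>, \<open>\<delta> = \<lambda> + m \<alpha>\<close> and \<open>b = A\<^sup>T y\<close>. For a feasible
  \<open>(x, X)\<close>, \<open>m\<close> times the objective is at least \<open>\<parallel>y\<parallel>\<^sup>2 - 2 b \<bullet> x + \<delta> tr X\<close>. Put
  \<open>t\<^sub>i = x\<^sub>i\<^sup>2 / X\<^sub>i\<^sub>i\<close>: the constraint \<open>X \<succeq> x x\<^sup>T\<close> gives \<open>0 \<le> t\<^sub>i \<le> 1\<close>, and together with
  \<open>k diag(X) \<succeq> X\<close> it gives \<open>\<Sum>\<^sub>i t\<^sub>i \<le> k\<close>. Completing squares,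
  \<open>2 b \<bullet> x - \<delta> tr X \<le> (1 / \<delta>) \<Sum>\<^sub>i t\<^sub>i b\<^sub>i\<^sup>2\<close>, and the right-hand side is at most
  \<open>L\<^sup>2 / \<delta>\<close> times the sum of \<open>(y \<bullet> a\<^sub>i)\<^sup>2\<close> over some \<open>k\<close>-element set, where the \<open>a\<^sub>i\<close> are the
  normalized columns. By Gershgorin's bound \<open>\<tau>\<close> on the Gram matrix of these \<open>a\<^sub>i\<close>, a single
  \<open>k\<close>-sparse test vector shows that this sum is at most \<open>\<tau> (\<parallel>y\<parallel>\<^sup>2 - m r\<^sub>0)\<close>, which gives the
  lower bound on the relaxation. When \<open>\<tau> \<eta> = 1\<close> that bound is \<open>r\<^sub>0\<close>, and the gap estimate
  compares it with the objective at \<open>x\<^sub>0\<close>.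
\<close>

section \<open>Sums, matrix inner products and quadratic forms\<close>

lemma sum_option_UNIV:
  "(\<Sum>i\<in>(UNIV::'n::finite option set). f i) = f None + (\<Sum>i\<in>UNIV. f (Some i))"
proof -
  have "(\<Sum>i\<in>(UNIV::'n option set). f i) = f None + sum f (range Some)"
    by (simp add: UNIV_option_conv)
  then show ?thesis by (simp add: sum.reindex)
qed

lemma mat_inner_sum: "mat_inner M N = (\<Sum>i\<in>UNIV. \<Sum>j\<in>UNIV. M $ i $ j * N $ i $ j)"
  unfolding mat_inner_def trace_def matrix_matrix_mult_def transpose_def
  by (subst sum.swap) (simp add: mult.commute)

lemma mat_inner_add_left: "mat_inner (M + N) X = mat_inner M X + mat_inner N X"
  by (simp add: mat_inner_sum sum.distrib distrib_right)

lemma mat_inner_scaleR_left: "mat_inner (c *\<^sub>R M) X = c * mat_inner M X"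
  by (simp add: mat_inner_sum sum_distrib_left mult.assoc)

lemma mat_inner_diff_left: "mat_inner (M - N) X = mat_inner M X - mat_inner N X"
  by (simp add: mat_inner_sum sum_subtractf left_diff_distrib)

lemma mat_inner_mat_1: "mat_inner (mat 1) X = trace X" for X :: "real^'n^'n"
proof -
  have "(\<Sum>j\<in>UNIV. (mat 1 :: real^'n^'n) $ i $ j * X $ i $ j) = X $ i $ i" for i :: 'n
  proof -
    have "(\<Sum>j\<in>UNIV. (mat 1 :: real^'n^'n) $ i $ j * X $ i $ j)
        = (\<Sum>j\<in>UNIV. if i = j then X $ i $ i else 0)"
      by (rule sum.cong) (auto simp: mat_def)
    then show ?thesis by simp
  qed
  then show ?thesis by (simp add: mat_inner_sum trace_def)
qed

lemma quad_form_sum: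
  "u \<bullet> (M *v v) = (\<Sum>i\<in>UNIV. \<Sum>j\<in>UNIV. u $ i * M $ i $ j * v $ j)" for M :: "real^'n^'m"
  by (simp add: inner_vec_def matrix_vector_mult_def sum_distrib_left mult.assoc)

lemma quad_form_axis_axis: "axis i 1 \<bullet> (M *v axis j 1) = M $ i $ j" for M :: "real^'n^'n"
  by (simp add: inner_axis' matrix_vector_mult_basis column_def)

lemma symmetric_mat_entry: "symmetric_mat M \<Longrightarrow> M $ p $ q = M $ q $ p"
  by (simp add: symmetric_mat_def transpose_def vec_eq_iff)

lemma quad_form_symmetric:
  assumes "symmetric_mat M"
  shows "u \<bullet> (M *v v) = v \<bullet> (M *v u)"
  using assms by (metis dot_lmul_matrix inner_commute symmetric_mat_def vector_transpose_matrix)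

section \<open>Positive semidefinite matrices\<close>

text \<open>The form at \<open>s u + t v\<close> is a nonnegative quadratic in
  \<open>(s, t)\<close>. Taking \<open>s = ?c\<close>, \<open>t = - ?b\<close> gives the claim
  multiplied by \<open>?c\<close>, so a singular direction \<open>?c = 0\<close> needs its own
  argument.\<close>

lemma psd_cauchy_schwarz:
  assumes "psd M"
  shows "(u \<bullet> (M *v v))\<^sup>2 \<le> (u \<bullet> (M *v u)) * (v \<bullet> (M *v v))"
proof -
  let ?a = "u \<bullet> (M *v u)" and ?b = "u \<bullet> (M *v v)" and ?c = "v \<bullet> (M *v v)"
  have sym: "v \<bullet> (M *v u) = ?b"
    using assms quad_form_symmetric unfolding psd_def by metis
  have quad: "0 \<le> s\<^sup>2 * ?a + 2 * s * t * ?b + t\<^sup>2 * ?c" for s t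
  proof -
    have "0 \<le> (s *\<^sub>R u + t *\<^sub>R v) \<bullet> (M *v (s *\<^sub>R u + t *\<^sub>R v))"
      using assms by (simp add: psd_def)
    also have "\<dots> = s\<^sup>2 * ?a + 2 * s * t * ?b + t\<^sup>2 * ?c"
      by (simp add: matrix_vector_right_distrib matrix_vector_mult_scaleR inner_add_left inner_add_right
          sym algebra_simps power2_eq_square)
    finally show ?thesis .
  qed
  have a: "0 \<le> ?a" and c: "0 \<le> ?c"
    using assms by (auto simp: psd_def)
  show ?thesis
  proof (cases "?c = 0")
    case True
    have "?b = 0"
    proof (rule ccontr)
      assume "?b \<noteq> 0"
      \<comment> \<open>With \<open>?c = 0\<close> and \<open>s = 1\<close> the quadratic is affine
        in \<open>t\<close>; this \<open>t\<close> is chosen to give it the value -1.\<close>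
      have "0 \<le> ?a + 2 * (- (?a + 1) / (2 * ?b)) * ?b"
        using quad[of 1 "- (?a + 1) / (2 * ?b)"] True by simp
      also have "\<dots> = - 1" using \<open>?b \<noteq> 0\<close> by (simp add: field_simps)
      finally show False by simp
    qed
    then show ?thesis using True by simp
  next
    case False
    then have "0 < ?c" using c by simp
    have "0 \<le> ?c\<^sup>2 * ?a - 2 * ?c * ?b * ?b + ?b\<^sup>2 * ?c"
      using quad[of ?c "- ?b"] by simp
    also have "\<dots> = ?c * (?a * ?c - ?b\<^sup>2)"
      by (simp add: algebra_simps power2_eq_square)
    finally show ?thesis using \<open>0 < ?c\<close> by (simp add: zero_le_mult_iff)
  qed
qed

lemma psd_diag_nonneg: "psd M \<Longrightarrow> 0 \<le> M $ i $ i"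
  unfolding psd_def by (metis quad_form_axis_axis)

lemma psd_entry_sq_le:
  assumes "psd M" shows "(M $ i $ j)\<^sup>2 \<le> M $ i $ i * M $ j $ j"
  using psd_cauchy_schwarz[OF assms, of "axis i 1" "axis j 1"] by (simp add: quad_form_axis_axis)

text \<open>Induction on the number of nonzero diagonal entries: subtracting the rank-one matrix of
  a Cholesky step keeps \<open>X\<close> positive semidefinite and clears one of them.\<close>

lemma mat_inner_psd_nonneg:
  fixes N X :: "real^'n^'n"
  assumes N: "psd N"
  shows "psd X \<Longrightarrow> 0 \<le> mat_inner N X"
proof (induction "card {i. X $ i $ i \<noteq> 0}" arbitrary: X rule: less_induct)
  case less
  show ?case
  proof (cases "\<exists>i. X $ i $ i \<noteq> 0")
    case False
    then have "X $ i $ j = 0" for i j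
      using psd_entry_sq_le[OF less.prems, of i j] by simp
    then show ?thesis by (simp add: mat_inner_sum)
  next
    case True
    then obtain i where i: "X $ i $ i \<noteq> 0" by blast
    then have pos: "0 < X $ i $ i"
      using psd_diag_nonneg[OF less.prems, of i] by simp
    define u where "u = X *v axis i 1"
    have uj: "u $ j = X $ j $ i" for j
      by (simp add: u_def matrix_vector_mult_basis column_def)
    have sym: "X $ p $ q = X $ q $ p" for p q
      using less.prems unfolding psd_def by (blast intro: symmetric_mat_entry)
    define Y :: "real^'n^'n" where "Y = (\<chi> p q. X $ p $ q - u $ p * u $ q / X $ i $ i)"
    have quadY: "v \<bullet> (Y *v v) = v \<bullet> (X *v v) - (v \<bullet> u)\<^sup>2 / X $ i $ i" for v
    proof -
      have "(v \<bullet> u)\<^sup>2 = (\<Sum>p\<in>UNIV. \<Sum>q\<in>UNIV. (v $ p * u $ p) * (v $ q * u $ q))"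
        by (simp add: power2_eq_square inner_vec_def sum_product)
      moreover have "v $ p * Y $ p $ q * v $ q
          = v $ p * X $ p $ q * v $ q - (v $ p * u $ p) * (v $ q * u $ q) / X $ i $ i" for p q
        by (simp add: Y_def algebra_simps)
      ultimately show ?thesis
        by (simp only: quad_form_sum sum_subtractf sum_divide_distrib)
    qed
    have "psd Y"
      unfolding psd_def
    proof
      show "symmetric_mat Y"
        by (simp add: symmetric_mat_def transpose_def Y_def vec_eq_iff sym mult.commute)
      show "\<forall>v. 0 \<le> v \<bullet> (Y *v v)"
      proof
        fix v
        \<comment> \<open>Since \<open>u\<close> is the image of the \<open>i\<close>-th basis
          vector, Cauchy-Schwarz against that vector is exactly nonnegativity of the form of
          \<open>Y\<close>.\<close>
        have "(v \<bullet> u)\<^sup>2 \<le> (v \<bullet> (X *v v)) * X $ i $ i"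
          using psd_cauchy_schwarz[OF less.prems, of v "axis i 1"]
          by (simp add: u_def quad_form_axis_axis)
        then show "0 \<le> v \<bullet> (Y *v v)"
          using pos by (simp add: quadY field_simps)
      qed
    qed
    moreover have "card {j. Y $ j $ j \<noteq> 0} < card {j. X $ j $ j \<noteq> 0}"
    proof (rule psubset_card_mono)
      \<comment> \<open>The pivot is cleared, and no zero is lost: \<open>X $ j $ j = 0\<close>
        forces \<open>X $ j $ i = 0\<close>, so \<open>u $ j = 0\<close>.\<close>
      have "Y $ i $ i = 0" using pos by (simp add: Y_def uj)
      moreover have "Y $ j $ j = 0" if "X $ j $ j = 0" for j
        using that psd_entry_sq_le[OF less.prems, of j i] by (simp add: Y_def uj)
      ultimately show "{j. Y $ j $ j \<noteq> 0} \<subset> {j. X $ j $ j \<noteq> 0}" using i by blast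
    qed simp
    ultimately have "0 \<le> mat_inner N Y" using less.hyps by blast
    moreover have "mat_inner N X = mat_inner N Y + (u \<bullet> (N *v u)) / X $ i $ i"
    proof -
      have "N $ p $ q * X $ p $ q
          = N $ p $ q * Y $ p $ q + u $ p * N $ p $ q * u $ q / X $ i $ i" for p q
        by (simp add: Y_def algebra_simps)
      then show ?thesis
        by (simp only: mat_inner_sum quad_form_sum sum.distrib sum_divide_distrib)
    qed
    ultimately show ?thesis using N pos by (simp add: psd_def)
  qed
qed

section \<open>The smallest eigenvalue and Gram matrices\<close>

text \<open>Eigenvectors for distinct eigenvalues are orthogonal, so picking one per eigenvalue
  yields an independent set. Finiteness is what gives the \<open>Min\<close> in
  \<open>lambda_min\<close> its meaning.\<close>

lemma finite_eigenvalues_symmetric: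
  fixes M :: "real^'n^'n"
  assumes "symmetric_mat M"
  shows "finite {l. eigenvalue M l}"
proof -
  have "\<forall>l. \<exists>v. eigenvalue M l \<longrightarrow> v \<noteq> 0 \<and> M *v v = l *\<^sub>R v"
    by (auto simp: eigenvalue_def)
  then obtain f where f: "\<And>l. eigenvalue M l \<Longrightarrow> f l \<noteq> 0 \<and> M *v f l = l *\<^sub>R f l"
    by metis
  let ?E = "{l. eigenvalue M l}"
  have orth: "f a \<bullet> f b = 0" if "a \<in> ?E" "b \<in> ?E" "a \<noteq> b" for a b
  proof -
    have "b * (f a \<bullet> f b) = a * (f a \<bullet> f b)"
      using quad_form_symmetric[OF assms, of "f a" "f b"] f that by (simp add: inner_commute)
    then show ?thesis using that by simp
  qed
  have inj: "inj_on f ?E"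
    by (rule inj_onI) (metis f inner_eq_zero_iff mem_Collect_eq orth)
  have "pairwise orthogonal (f ` ?E)"
    using orth by (auto simp: pairwise_def orthogonal_def)
  moreover have "0 \<notin> f ` ?E" using f by force
  ultimately have "independent (f ` ?E)" by (rule pairwise_orthogonal_independent)
  then have "finite (f ` ?E)" by (rule finiteI_independent)
  then show ?thesis using inj finite_imageD by blast
qed

text \<open>A minimiser of the Rayleigh quotient is an eigenvector: \<open>M - q I\<close> is positive semidefinite
  and its quadratic form vanishes there, so by Cauchy--Schwarz \<open>M - q I\<close> kills it.\<close>

lemma lambda_min_props:
  fixes M :: "real^'n^'n"
  assumes sym: "symmetric_mat M"
  shows eigenvalue_lambda_min: "eigenvalue M (lambda_min M)"
    and psd_diff_lambda_min: "psd (M - lambda_min M *\<^sub>R mat 1)"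
proof -
  let ?S = "sphere (0::real^'n) 1"
  have "(axis undefined 1 :: real^'n) \<in> ?S" by (simp add: norm_axis_1)
  then have "?S \<noteq> {}" by blast
  moreover have "continuous_on ?S (\<lambda>v. v \<bullet> (M *v v))"
    by (intro continuous_intros linear_continuous_on) simp
  ultimately obtain w where w: "norm w = 1"
    and wmin: "\<And>v. norm v = 1 \<Longrightarrow> w \<bullet> (M *v w) \<le> v \<bullet> (M *v v)"
    using continuous_attains_inf[OF compact_sphere] by (metis (no_types, lifting) dist_0_norm mem_sphere)
  define q where "q = w \<bullet> (M *v w)"
  have mult: "(M - c *\<^sub>R mat 1) *v v = M *v v - c *\<^sub>R v" for c v
    by (simp add: matrix_vector_mult_diff_rdistrib scaleR_matrix_vector_assoc[symmetric])
  have symc: "symmetric_mat (M - c *\<^sub>R mat 1)" for c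
    using sym by (auto simp: symmetric_mat_def transpose_def vec_eq_iff mat_def)
  have rayleigh: "q * (v \<bullet> v) \<le> v \<bullet> (M *v v)" for v
  proof (cases "v = 0")
    case False
    let ?u = "(1 / norm v) *\<^sub>R v"
    have "q \<le> ?u \<bullet> (M *v ?u)" unfolding q_def using False by (intro wmin) simp
    then show ?thesis using False
      by (simp add: matrix_vector_mult_scaleR field_simps power2_eq_square flip: power2_norm_eq_inner)
  qed simp
  have psdq: "psd (M - q *\<^sub>R mat 1)"
    using rayleigh symc by (simp add: psd_def mult inner_diff_right)
  have "w \<bullet> ((M - q *\<^sub>R mat 1) *v w) = 0"
    using w by (simp add: mult inner_diff_right q_def flip: power2_norm_eq_inner)
  then have "u \<bullet> ((M - q *\<^sub>R mat 1) *v w) = 0" for u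
    using psd_cauchy_schwarz[OF psdq, of u w] by simp
  then have "(M - q *\<^sub>R mat 1) *v w = 0" by (metis inner_eq_zero_iff)
  then have "eigenvalue M q"
    unfolding eigenvalue_def using w by (intro exI[of _ w]) (auto simp: mult)
  then have "lambda_min M \<le> q" and ev: "eigenvalue M (lambda_min M)"
    using finite_eigenvalues_symmetric[OF sym] Min_in[of "{l. eigenvalue M l}"]
    by (auto simp: lambda_min_def)
  then have "lambda_min M * (v \<bullet> v) \<le> v \<bullet> (M *v v)" for v
    using rayleigh[of v] mult_right_mono[of "lambda_min M" q "v \<bullet> v"] by simp
  then show "psd (M - lambda_min M *\<^sub>R mat 1)"
    using symc by (simp add: psd_def mult inner_diff_right)
  show "eigenvalue M (lambda_min M)" by (fact ev)
qed

lemma gram_entry: "(transpose A ** A) $ i $ j = column i A \<bullet> column j A" for A :: "real^'n^'m"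
  by (simp add: matrix_mult_transpose_dot_column)

lemma symmetric_gram: "symmetric_mat (transpose A ** A)" for A :: "real^'n^'m"
  by (simp add: symmetric_mat_def matrix_transpose_mul)

lemma quad_form_gram: "v \<bullet> ((transpose A ** A) *v v) = (norm (A *v v))\<^sup>2" for A :: "real^'n^'m"
proof -
  have "v \<bullet> (transpose A *v (A *v v)) = (v v* transpose A) \<bullet> (A *v v)"
    by (simp only: dot_lmul_matrix)
  then show ?thesis
    by (simp add: vector_transpose_matrix power2_norm_eq_inner flip: matrix_vector_mul_assoc)
qed

lemma lambda_min_gram_nonneg: "0 \<le> lambda_min (transpose A ** A)" for A :: "real^'n^'m"
proof -
  obtain v where v: "v \<noteq> 0" "(transpose A ** A) *v v = lambda_min (transpose A ** A) *\<^sub>R v"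
    using eigenvalue_lambda_min[OF symmetric_gram] unfolding eigenvalue_def by blast
  then have "lambda_min (transpose A ** A) * (v \<bullet> v) = (norm (A *v v))\<^sup>2"
    by (metis quad_form_gram inner_scaleR_right)
  then show ?thesis using v(1)
    by (metis inner_gt_zero_iff zero_le_mult_iff zero_le_power2 not_less)
qed

text \<open>Read off from a diagonal entry of the positive semidefinite matrix
  \<open>A^T A - \<lambda> I\<close>. For a column of maximal norm it yields
  \<open>0 \<le> alpha_bar A k\<close>.\<close>

lemma lambda_min_gram_le:
  "lambda_min (transpose A ** A) \<le> (norm (column i A))\<^sup>2" for A :: "real^'n^'m"
  using psd_diag_nonneg[OF psd_diff_lambda_min[OF symmetric_gram], of A i]
  by (simp add: gram_entry mat_def power2_norm_eq_inner)

section \<open>Column norms and coherence\<close>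

lemma norm_column_le_max: "norm (column j A) \<le> max_column_norm A"
  unfolding max_column_norm_def by (rule Max_ge) (auto simp: columns_def full_SetCompr_eq)

lemma max_column_norm_attained: "\<exists>j. max_column_norm A = norm (column j A)"
proof -
  have "max_column_norm A \<in> norm ` columns A"
    unfolding max_column_norm_def by (rule Max_in) (auto simp: columns_def full_SetCompr_eq)
  then show ?thesis by (auto simp: columns_def)
qed

lemma
  fixes A :: "real^'n^'m"
  assumes "i \<noteq> j"
  shows abs_inner_column_le_coherence: "\<bar>column i A \<bullet> column j A\<bar> \<le> coherence A"
    and coherence_attained: "\<exists>p q. p \<noteq> q \<and> coherence A = \<bar>column p A \<bullet> column q A\<bar>"
proof -
  let ?C = "{\<bar>column i A \<bullet> column j A\<bar> | i j. i \<noteq> j}"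
  have "?C \<subseteq> range (\<lambda>(i, j). \<bar>column i A \<bullet> column j A\<bar>)" by auto
  then have fin: "finite ?C" by (rule finite_subset) simp
  show "\<bar>column i A \<bullet> column j A\<bar> \<le> coherence A"
    unfolding coherence_def using assms by (intro Max_ge[OF fin]) blast
  have "coherence A \<in> ?C"
    unfolding coherence_def using assms by (intro Max_in[OF fin]) blast
  then show "\<exists>p q. p \<noteq> q \<and> coherence A = \<bar>column p A \<bullet> column q A\<bar>" by blast
qed

lemma exists_distinct_if_card_ge_2:
  assumes "2 \<le> CARD('a::finite)"
  shows "\<exists>i j :: 'a::finite. i \<noteq> j"
proof (rule ccontr)
  assume "\<not> (\<exists>i j :: 'a. i \<noteq> j)"
  then have "(UNIV :: 'a set) = {undefined}" by blast
  then have "CARD('a) = card {undefined :: 'a}" by (rule arg_cong)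
  then show False using assms by simp
qed

lemma coherence_bounds:
  fixes B :: "real^'n^'m"
  assumes "\<And>j. norm (column j B) = 1" and "2 \<le> CARD('n)"
  shows "0 \<le> coherence B" and "coherence B \<le> 1"
proof -
  obtain i j :: 'n where "i \<noteq> j" using exists_distinct_if_card_ge_2[OF assms(2)] by blast
  then obtain p q where pq: "coherence B = \<bar>column p B \<bullet> column q B\<bar>"
    using coherence_attained by blast
  then show "0 \<le> coherence B" by simp
  show "coherence B \<le> 1"
    using Cauchy_Schwarz_ineq2[of "column p B" "column q B"] pq assms(1) by simp
qed

text \<open>Gershgorin bound for the Gram matrix of the columns in \<open>S\<close>; the off-diagonal part is
  controlled by \<open>(\<Sum>j\<in>S. \<bar>c j\<bar>)\<^sup>2 \<le> k (\<Sum>j\<in>S. (c j)\<^sup>2)\<close>.\<close>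

lemma norm_combination_le_coherence:
  fixes B :: "real^'n^'m"
  assumes unit: "\<And>j. norm (column j B) = 1"
    and S: "card S \<le> k" and k: "k \<le> CARD('n)" "1 \<le> k"
  shows "(norm (\<Sum>j\<in>S. c j *\<^sub>R column j B))\<^sup>2
    \<le> (1 + (real k - 1) * coherence B) * (\<Sum>j\<in>S. (c j)\<^sup>2)"
proof -
  let ?\<mu> = "coherence B" and ?Q = "\<Sum>j\<in>S. (c j)\<^sup>2" and ?T = "\<Sum>j\<in>S. \<bar>c j\<bar>"
  have fin: "finite S" by simp
  have "(norm (\<Sum>j\<in>S. c j *\<^sub>R column j B))\<^sup>2
      = (\<Sum>i\<in>S. \<Sum>j\<in>S. c i * c j * (column i B \<bullet> column j B))"
    by (simp add: power2_norm_eq_inner inner_sum_left inner_sum_right sum_distrib_left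
        inner_commute mult_ac)
  \<comment> \<open>The diagonal term \<open>(c i)^2\<close> is split with weights \<mu> and 1 -
    \<mu>, so that the \<mu> parts of all pairs together form \<open>?\<mu> * ?T^2\<close>.\<close>
  also have "\<dots> \<le> (\<Sum>i\<in>S. \<Sum>j\<in>S. ?\<mu> * (\<bar>c i\<bar> * \<bar>c j\<bar>) + (if i = j then (1 - ?\<mu>) * (c i)\<^sup>2 else 0))"
  proof (intro sum_mono)
    fix i j
    show "c i * c j * (column i B \<bullet> column j B)
        \<le> ?\<mu> * (\<bar>c i\<bar> * \<bar>c j\<bar>) + (if i = j then (1 - ?\<mu>) * (c i)\<^sup>2 else 0)"
    proof (cases "i = j")
      case True
      then show ?thesis
        using unit[of j] by (simp add: algebra_simps power2_eq_square flip: power2_norm_eq_inner)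
    next
      case False
      have "c i * c j * (column i B \<bullet> column j B) \<le> \<bar>c i * c j\<bar> * \<bar>column i B \<bullet> column j B\<bar>"
        by (metis abs_ge_self abs_mult)
      also have "\<dots> \<le> \<bar>c i * c j\<bar> * ?\<mu>"
        using abs_inner_column_le_coherence[OF False, of B] by (rule mult_left_mono) simp
      finally show ?thesis using False by (simp add: abs_mult mult.commute)
    qed
  qed
  also have "\<dots> = ?\<mu> * ?T\<^sup>2 + (1 - ?\<mu>) * ?Q"
    using fin by (simp add: sum.distrib power2_eq_square sum_product flip: sum_distrib_left)
  also have "\<dots> \<le> (1 + (real k - 1) * ?\<mu>) * ?Q"
  proof (cases "k = 1")
    \<comment> \<open>With a single column the coherence is unspecified and its sign unknown; here
      it cancels because \<open>?T^2 = ?Q\<close> when \<open>S\<close> has at most one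
      element.\<close>
    case True
    then have "S = {} \<or> (\<exists>j. S = {j})"
      using S by (metis One_nat_def card_0_eq card_1_singletonE fin le_SucE le_zero_eq)
    then have "?T\<^sup>2 = ?Q" by auto
    then show ?thesis using True by (simp add: algebra_simps)
  next
    case False
    then have "0 \<le> ?\<mu>" using coherence_bounds(1)[OF unit] k by simp
    have "?T\<^sup>2 \<le> (\<Sum>j\<in>S. 1\<^sup>2) * (\<Sum>j\<in>S. \<bar>c j\<bar>\<^sup>2)"
      using Cauchy_Schwarz_ineq_sum[of "\<lambda>j. 1" "\<lambda>j. \<bar>c j\<bar>" S] by simp
    also have "\<dots> = real (card S) * ?Q" by simp
    also have "\<dots> \<le> real k * ?Q" using S by (intro mult_right_mono) (auto intro: sum_nonneg)
    finally have "?\<mu> * ?T\<^sup>2 \<le> ?\<mu> * (real k * ?Q)"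
      using \<open>0 \<le> ?\<mu>\<close> by (rule mult_left_mono)
    then show ?thesis by (simp add: algebra_simps)
  qed
  finally show ?thesis .
qed

section \<open>Fractional selections against \<open>k\<close>-element sets\<close>

text \<open>Exchange argument: in a \<open>k\<close>-element set of maximal total value, swapping a
  member for an outsider cannot increase the sum.\<close>

lemma exists_top_subset:
  fixes c :: "'a::finite \<Rightarrow> real"
  assumes "k \<le> CARD('a)"
  obtains S where "card S = k" and "\<And>i j. i \<in> S \<Longrightarrow> j \<notin> S \<Longrightarrow> c j \<le> c i"
proof -
  let ?F = "{S::'a set. card S = k}"
  obtain S0 :: "'a set" where "card S0 = k"
    using assms obtain_subset_with_card_n by (metis)
  then have "Max (sum c ` ?F) \<in> sum c ` ?F" by (intro Max_in) auto
  then obtain S where S: "S \<in> ?F" and "Max (sum c ` ?F) = sum c S" by blast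
  then have max: "sum c U \<le> sum c S" if "U \<in> ?F" for U
    using that by (metis Max_ge finite finite_imageI imageI)
  have "c j \<le> c i" if "i \<in> S" "j \<notin> S" for i j
  proof -
    let ?U = "insert j (S - {i})"
    have "card ?U = k"
      using that S card_Suc_Diff1[of S i] by simp
    then have "sum c ?U \<le> sum c S" by (intro max) simp
    moreover have "sum c ?U = c j + sum c (S - {i})" using that by simp
    moreover have "sum c S = c i + sum c (S - {i})" using that by (intro sum.remove) auto
    ultimately show ?thesis by simp
  qed
  then show ?thesis using that S by blast
qed

text \<open>A linear functional with nonnegative coefficients, over weights in [0, 1] of total at
  most \<open>k\<close>, is maximised by the indicator of a top set. The least value \<theta> in
  that set acts as the threshold (a dual multiplier).\<close>

lemma weighted_sum_le_top_subset:
  fixes c t :: "'a::finite \<Rightarrow> real"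
  assumes k: "1 \<le> k" "k \<le> CARD('a)" and c: "\<And>i. 0 \<le> c i"
    and t: "\<And>i. 0 \<le> t i" "\<And>i. t i \<le> 1" "(\<Sum>i\<in>UNIV. t i) \<le> real k"
  obtains S where "card S = k" and "(\<Sum>i\<in>UNIV. t i * c i) \<le> (\<Sum>i\<in>S. c i)"
proof -
  obtain S where S: "card S = k" and top: "\<And>i j. i \<in> S \<Longrightarrow> j \<notin> S \<Longrightarrow> c j \<le> c i"
    using exists_top_subset[OF k(2), of c] by blast
  define \<theta> where "\<theta> = Min (c ` S)"
  have "S \<noteq> {}" using S k by auto
  then have "\<theta> \<in> c ` S" unfolding \<theta>_def by (intro Min_in) auto
  then have \<theta>: "0 \<le> \<theta>" "\<And>i. i \<in> S \<Longrightarrow> \<theta> \<le> c i" "\<And>j. j \<notin> S \<Longrightarrow> c j \<le> \<theta>"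
    using c top by (auto simp: \<theta>_def)
  let ?s = "\<lambda>i. if i \<in> S then 1 else 0 :: real"
  \<comment> \<open>On \<open>S\<close> the factor \<open>t i - 1\<close> is nonpositive and
    \<open>c i\<close> is at least \<theta>; off \<open>S\<close> the factor \<open>t i\<close> is
    nonnegative and \<open>c i\<close> is at most \<theta>.\<close>
  have "(t i - ?s i) * c i \<le> (t i - ?s i) * \<theta>" for i
    using \<theta>(2,3)[of i] t(1,2)[of i] by (auto intro: mult_left_mono mult_left_mono_neg)
  then have "(\<Sum>i\<in>UNIV. (t i - ?s i) * c i) \<le> (\<Sum>i\<in>UNIV. (t i - ?s i) * \<theta>)"
    by (rule sum_mono)
  also have "\<dots> = ((\<Sum>i\<in>UNIV. t i) - real k) * \<theta>"
    using S by (simp add: sum_subtractf sum.If_cases flip: sum_distrib_right)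
  also have "\<dots> \<le> 0" using t(3) \<theta>(1) by (simp add: mult_le_0_iff)
  finally have "(\<Sum>i\<in>UNIV. t i * c i) \<le> (\<Sum>i\<in>UNIV. ?s i * c i)"
    by (simp add: left_diff_distrib sum_subtractf)
  also have "\<dots> = (\<Sum>i\<in>UNIV. if i \<in> S then c i else 0)" by (rule sum.cong) auto
  also have "\<dots> = (\<Sum>i\<in>S. c i)" by (simp add: sum.If_cases)
  finally show ?thesis using that S by blast
qed

section \<open>Normalized columns and the explained part of \<open>y\<close>\<close>

lemma column_normalize_columns:
  "column j (normalize_columns A) = (1 / norm (column j A)) *\<^sub>R column j A"
  by (simp add: vec_eq_iff column_def normalize_columns_def)

lemma norm_column_normalize_columns:
  "column j A \<noteq> 0 \<Longrightarrow> norm (column j (normalize_columns A)) = 1"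
  by (simp add: column_normalize_columns)

text \<open>For \<open>k = 1\<close> the factor \<open>real k - 1\<close> removes the possibly
  unspecified coherence; otherwise there are two columns and Cauchy-Schwarz puts the coherence in
  [0, 1].\<close>

lemma tau_bounds:
  fixes A :: "real^'n^'m"
  assumes "\<And>j. column j A \<noteq> 0" and k: "1 \<le> k" "k \<le> CARD('n)"
  shows "1 \<le> tau A k" and "tau A k \<le> real k"
proof -
  let ?\<mu> = "coherence (normalize_columns A)"
  have "0 \<le> (real k - 1) * ?\<mu> \<and> (real k - 1) * ?\<mu> \<le> real k - 1"
  proof (cases "k = 1")
    case False
    then have "0 \<le> ?\<mu>" "?\<mu> \<le> 1"
      using coherence_bounds[of "normalize_columns A"] norm_column_normalize_columns assms by auto
    then show ?thesis using k by (simp add: mult_left_le)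
  qed simp
  then show "1 \<le> tau A k" "tau A k \<le> real k" by (auto simp: tau_def)
qed

lemma matrix_vector_mult_columns: "A *v x = (\<Sum>j\<in>UNIV. x $ j *\<^sub>R column j A)" for A :: "real^'n^'m"
  by (simp add: matrix_mult_sum scalar_mult_eq_scaleR)

lemma inner_matrix_vector_mult:
  "y \<bullet> (A *v x) = (\<Sum>j\<in>UNIV. x $ j * (y \<bullet> column j A))" for A :: "real^'n^'m"
  by (simp add: matrix_vector_mult_columns inner_sum_right)

text \<open>The test vector is the one whose image under \<open>A\<close> is
  \<open>(1 / \<tau>) (\<Sum>j\<in>S. (y \<bullet> a\<^sub>j) a\<^sub>j)\<close> with \<open>a\<^sub>j\<close> the normalized columns.\<close>

lemma sum_correlations_le_explained:
  fixes A :: "real^'n^'m"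
  assumes nz: "\<And>j. column j A \<noteq> 0" and k: "1 \<le> k" "k \<le> CARD('n)"
    and S: "card S \<le> k"
    and r: "\<And>x. l0_norm x \<le> k \<Longrightarrow> r \<le> (norm (y - A *v x))\<^sup>2"
  shows "(\<Sum>j\<in>S. (y \<bullet> column j (normalize_columns A))\<^sup>2) \<le> tau A k * ((norm y)\<^sup>2 - r)"
proof -
  let ?B = "normalize_columns A" and ?\<tau> = "tau A k"
  let ?\<beta> = "\<Sum>j\<in>S. (y \<bullet> column j ?B)\<^sup>2"
  define g where "g = (\<Sum>j\<in>S. (y \<bullet> column j ?B) *\<^sub>R column j ?B)"
  define x where "x = (\<chi> j. if j \<in> S then (y \<bullet> column j ?B) / (?\<tau> * norm (column j A)) else 0)"
  have \<tau>: "0 < ?\<tau>" using tau_bounds(1)[of A k] nz k by fastforce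
  have "l0_norm x \<le> card S"
    unfolding l0_norm_def by (intro card_mono) (auto simp: x_def split: if_splits)
  then have "r \<le> (norm (y - A *v x))\<^sup>2" using r S by simp
  moreover have "A *v x = (1 / ?\<tau>) *\<^sub>R g"
  proof -
    have "x $ j *\<^sub>R column j A
        = (if j \<in> S then (1 / ?\<tau>) *\<^sub>R (y \<bullet> column j ?B) *\<^sub>R column j ?B else 0)" for j
      by (simp add: x_def column_normalize_columns)
    then show ?thesis
      by (simp add: matrix_vector_mult_columns g_def sum.If_cases scaleR_sum_right)
  qed
  moreover have "(norm (y - (1 / ?\<tau>) *\<^sub>R g))\<^sup>2
      = (norm y)\<^sup>2 - 2 / ?\<tau> * (y \<bullet> g) + (norm g)\<^sup>2 / ?\<tau>\<^sup>2"
    unfolding power2_norm_eq_inner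
    by (simp add: inner_diff_left inner_diff_right inner_commute[of g y] power2_eq_square
        diff_divide_distrib)
  moreover have "y \<bullet> g = ?\<beta>"
    by (simp add: g_def inner_sum_right power2_eq_square)
  moreover have "(norm g)\<^sup>2 / ?\<tau>\<^sup>2 \<le> ?\<beta> / ?\<tau>"
  proof -
    have "(norm g)\<^sup>2 \<le> ?\<tau> * ?\<beta>"
      unfolding g_def tau_def
      using S k norm_column_normalize_columns[OF nz] by (intro norm_combination_le_coherence) auto
    then have "(norm g)\<^sup>2 / ?\<tau>\<^sup>2 \<le> (?\<tau> * ?\<beta>) / ?\<tau>\<^sup>2" by (rule divide_right_mono) simp
    then show ?thesis using \<tau> by (simp add: power2_eq_square)
  qed
  \<comment> \<open>The scaling 1 / \<tau> minimises
    \<open>- 2 * s * ?\<beta> + s^2 * ?\<tau> * ?\<beta>\<close> over \<open>s\<close>, with minimum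
    \<open>- ?\<beta> / ?\<tau>\<close>.\<close>
  ultimately have "?\<beta> / ?\<tau> \<le> (norm y)\<^sup>2 - r" by simp
  then show ?thesis using \<tau> by (simp add: pos_divide_le_eq mult.commute)
qed

section \<open>Bordered matrices and the relaxed constraints\<close>

lemma quad_form_bordered:
  fixes X :: "real^'n^'n"
  shows "w \<bullet> (bordered c x X *v w) = c * (w $ None)\<^sup>2
    + 2 * w $ None * (x \<bullet> (\<chi> p. w $ Some p)) + (\<chi> p. w $ Some p) \<bullet> (X *v (\<chi> p. w $ Some p))"
proof -
  have "w $ None * (x \<bullet> (\<chi> p. w $ Some p)) = (\<Sum>p\<in>UNIV. w $ None * x $ p * w $ Some p)"
    by (simp add: inner_vec_def sum_distrib_left mult.assoc)
  moreover have "w $ None * (x \<bullet> (\<chi> p. w $ Some p)) = (\<Sum>p\<in>UNIV. w $ Some p * x $ p * w $ None)"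
    by (simp add: inner_vec_def sum_distrib_left mult_ac)
  ultimately show ?thesis
    by (simp add: quad_form_sum sum_option_UNIV bordered_def sum.distrib power2_eq_square)
qed

lemma symmetric_bordered: "symmetric_mat X \<Longrightarrow> symmetric_mat (bordered c x X)"
proof -
  assume "symmetric_mat X"
  then have "X $ p $ q = X $ q $ p" for p q by (rule symmetric_mat_entry)
  then show ?thesis
    by (simp add: symmetric_mat_def transpose_def bordered_def vec_eq_iff split: option.split)
qed

text \<open>This is the Schur complement condition \<open>X - x x^T\<close> positive semidefinite,
  in the form in which it is applied.\<close>

lemma psd_bordered_inner_sq_le:
  assumes "psd (bordered 1 x X)"
  shows "(v \<bullet> x)\<^sup>2 \<le> v \<bullet> (X *v v)"
proof -
  \<comment> \<open>This leading coordinate minimises the bordered form for fixed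
    \<open>v\<close>.\<close>
  let ?w = "\<chi> i. case i of None \<Rightarrow> - (v \<bullet> x) | Some p \<Rightarrow> v $ p"
  have "0 \<le> ?w \<bullet> (bordered 1 x X *v ?w)" using assms by (simp add: psd_def)
  then show ?thesis
    by (simp add: quad_form_bordered inner_commute[of x v] power2_eq_square)
qed

lemma quad_form_diag_mat: "v \<bullet> (diag_mat X *v v) = (\<Sum>i\<in>UNIV. X $ i $ i * (v $ i)\<^sup>2)"
proof -
  have "(\<Sum>j\<in>UNIV. v $ i * diag_mat X $ i $ j * v $ j) = X $ i $ i * (v $ i)\<^sup>2" for i
  proof -
    have "(\<Sum>j\<in>UNIV. v $ i * diag_mat X $ i $ j * v $ j)
        = (\<Sum>j\<in>UNIV. if i = j then X $ i $ i * (v $ i)\<^sup>2 else 0)"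
      by (rule sum.cong) (auto simp: diag_mat_def power2_eq_square)
    then show ?thesis by simp
  qed
  then show ?thesis by (simp add: quad_form_sum)
qed

lemma S_nk_quad_form_le:
  fixes X :: "real^'n^'n"
  assumes "X \<in> S_nk k"
  shows "v \<bullet> (X *v v) \<le> real k * (\<Sum>i\<in>UNIV. X $ i $ i * (v $ i)\<^sup>2)"
proof -
  have "0 \<le> v \<bullet> ((real k *\<^sub>R diag_mat X - X) *v v)"
    using assms by (simp add: S_nk_def loewner_ge_def psd_def)
  then show ?thesis
    by (simp add: matrix_vector_mult_diff_rdistrib inner_diff_right quad_form_diag_mat
        flip: scaleR_matrix_vector_assoc)
qed

text \<open>The ratios \<open>t i = x\<^sub>i\<^sup>2 / X\<^sub>i\<^sub>i\<close> play the role of a relaxed support indicator (\<open>t i = 0\<close> when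
  \<open>X\<^sub>i\<^sub>i = 0\<close>, where also \<open>x\<^sub>i = 0\<close>).\<close>

lemma relaxed_support:
  fixes X :: "real^'n^'n"
  assumes X: "X \<in> S_nk k" and Z: "psd (bordered 1 x X)"
  defines "t \<equiv> \<lambda>i. (x $ i)\<^sup>2 / X $ i $ i"
  shows "(x $ i)\<^sup>2 \<le> X $ i $ i" and "0 \<le> t i" and "t i \<le> 1" and "(\<Sum>i\<in>UNIV. t i) \<le> real k"
proof -
  show le: "(x $ i)\<^sup>2 \<le> X $ i $ i" for i
    using psd_bordered_inner_sq_le[OF Z, of "axis i 1"]
    by (simp add: inner_axis' matrix_vector_mult_basis column_def)
  then have nonneg: "0 \<le> X $ i $ i" for i by (meson order_trans zero_le_power2)
  then show "0 \<le> t i" by (simp add: t_def)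
  show "t i \<le> 1" using le[of i] nonneg[of i] by (auto simp: t_def divide_le_eq_1 less_le)
  \<comment> \<open>With this vector both \<open>X $ i $ i * (c $ i)^2\<close> and
    \<open>c $ i * x $ i\<close> equal \<open>t i\<close>, also when \<open>X $ i $ i = 0\<close>
    since division by zero gives 0. The two constraints then combine to
    \<open>T^2 \<le> real k * T\<close>.\<close>
  define c where "c = (\<chi> i. x $ i / X $ i $ i)"
  define T where "T = (\<Sum>i\<in>UNIV. t i)"
  have "X $ i $ i * (c $ i)\<^sup>2 = t i" for i
    by (simp add: c_def t_def power2_eq_square)
  then have "c \<bullet> (X *v c) \<le> real k * T"
    using S_nk_quad_form_le[OF X, of c] by (simp add: T_def)
  moreover have "c \<bullet> x = T"
    by (simp add: inner_vec_def c_def T_def t_def power2_eq_square)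
  ultimately have "T\<^sup>2 \<le> real k * T"
    using psd_bordered_inner_sq_le[OF Z, of c] by simp
  moreover have "0 \<le> T" unfolding T_def t_def using nonneg by (intro sum_nonneg) simp
  ultimately have "T \<le> real k"
    by (cases "T = 0") (auto simp: power2_eq_square)
  then show "(\<Sum>i\<in>UNIV. t i) \<le> real k" by (simp add: T_def)
qed

section \<open>The lower bound on the relaxation\<close>

lemma column_data_mat:
  "column None (data_mat A y) = y" "column (Some q) (data_mat A y) = - column q A"
  by (simp_all add: column_def data_mat_def vec_eq_iff)

lemma mat_inner_cost_bordered:
  fixes A :: "real^'n^'m"
  shows "mat_inner (cost_mat A y \<alpha>) (bordered 1 x X)
    = 1 / real CARD('m) * ((norm y)\<^sup>2 - 2 * (y \<bullet> (A *v x)) + mat_inner (transpose A ** A) X)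
      + \<alpha> * trace X"
proof -
  have "mat_inner (transpose (data_mat A y) ** data_mat A y) (bordered 1 x X)
      = (norm y)\<^sup>2 - 2 * (y \<bullet> (A *v x)) + mat_inner (transpose A ** A) X"
  proof -
    have "y \<bullet> (A *v x) = (\<Sum>j\<in>UNIV. (y \<bullet> column j A) * x $ j)"
      and "y \<bullet> (A *v x) = (\<Sum>j\<in>UNIV. (column j A \<bullet> y) * x $ j)"
      by (simp_all add: inner_matrix_vector_mult mult.commute inner_commute)
    then show ?thesis
      by (simp add: mat_inner_sum sum_option_UNIV gram_entry column_data_mat bordered_def
          sum.distrib sum_subtractf sum_negf power2_norm_eq_inner)
  qed
  moreover have "mat_inner (bordered 0 0 (mat 1)) (bordered 1 x X) = trace X"
  proof -
    have "mat_inner (bordered 0 0 (mat 1)) (bordered 1 x X) = mat_inner (mat 1) X"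
      by (simp add: mat_inner_sum sum_option_UNIV bordered_def)
    then show ?thesis by (simp add: mat_inner_mat_1)
  qed
  ultimately show ?thesis
    by (simp add: cost_mat_def mat_inner_add_left mat_inner_scaleR_left)
qed

text \<open>Here \<open>r\<close> is any lower bound on the squared residuals of
  \<open>k\<close>-sparse vectors; the theorem takes \<open>r\<close> to be \<open>m\<close> times
  \<open>r0\<close>.\<close>

lemma explained_le_relaxation:
  fixes A :: "real^'n^'m"
  assumes nz: "\<And>j. column j A \<noteq> 0" and k: "1 \<le> k" "k \<le> CARD('n)"
    and r: "\<And>x. l0_norm x \<le> k \<Longrightarrow> r \<le> (norm (y - A *v x))\<^sup>2"
    and pos: "0 < lambda_min (transpose A ** A) + real CARD('m) * \<alpha>"
    and X: "X \<in> S_nk k" and Z: "psd (bordered 1 x X)"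
  shows "(norm y)\<^sup>2 - tau A k * eta A \<alpha> * ((norm y)\<^sup>2 - r)
    \<le> real CARD('m) * mat_inner (cost_mat A y \<alpha>) (bordered 1 x X)"
proof -
  let ?\<delta> = "lambda_min (transpose A ** A) + real CARD('m) * \<alpha>"
  let ?L = "max_column_norm A"
  let ?b = "\<lambda>i. y \<bullet> column i A" and ?c = "\<lambda>i. (y \<bullet> column i (normalize_columns A))\<^sup>2"
  define t where "t i = (x $ i)\<^sup>2 / X $ i $ i" for i
  have t: "0 \<le> t i" "t i \<le> 1" "(\<Sum>i\<in>UNIV. t i) \<le> real k" for i
    using relaxed_support[OF X Z] by (auto simp: t_def)
  have summand: "2 * x $ i * ?b i - ?\<delta> * X $ i $ i \<le> ?L\<^sup>2 / ?\<delta> * (t i * ?c i)" for i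
  proof -
    have "2 * x $ i * ?b i - ?\<delta> * X $ i $ i \<le> t i * (?b i)\<^sup>2 / ?\<delta>"
    proof (cases "X $ i $ i = 0")
      case True
      then show ?thesis using relaxed_support(1)[OF X Z, of i] by (simp add: t_def)
    next
      case False
      then have "0 < X $ i $ i"
        using relaxed_support(1)[OF X Z, of i] zero_le_power2[of "x $ i"] by linarith
      then have "0 < ?\<delta> * X $ i $ i" using pos by simp
      \<comment> \<open>Completing the square, multiplied through by the positive number
        \<open>?\<delta> * X $ i $ i\<close>.\<close>
      moreover have "0 \<le> (?\<delta> * X $ i $ i - x $ i * ?b i)\<^sup>2" by simp
      then have "(2 * x $ i * ?b i - ?\<delta> * X $ i $ i) * (?\<delta> * X $ i $ i) \<le> (x $ i)\<^sup>2 * (?b i)\<^sup>2"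
        by (simp add: power2_eq_square algebra_simps)
      ultimately have "2 * x $ i * ?b i - ?\<delta> * X $ i $ i \<le> (x $ i)\<^sup>2 * (?b i)\<^sup>2 / (?\<delta> * X $ i $ i)"
        by (simp only: pos_le_divide_eq)
      then show ?thesis by (simp add: t_def mult.commute)
    qed
    also have "\<dots> \<le> t i * (?L\<^sup>2 * ?c i) / ?\<delta>"
    proof -
      have "(?b i)\<^sup>2 = (norm (column i A))\<^sup>2 * ?c i"
        using nz[of i] by (simp add: column_normalize_columns power_divide)
      also have "\<dots> \<le> ?L\<^sup>2 * ?c i"
        by (intro mult_right_mono power_mono norm_column_le_max) auto
      finally show ?thesis using pos t(1)[of i] by (intro divide_right_mono mult_left_mono) auto
    qed
    finally show ?thesis by (simp add: mult_ac)
  qed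
  obtain S where S: "card S = k" and top: "(\<Sum>i\<in>UNIV. t i * ?c i) \<le> (\<Sum>i\<in>S. ?c i)"
    using weighted_sum_le_top_subset[of k ?c t, OF k _ t] by auto
  have "2 * (y \<bullet> (A *v x)) - ?\<delta> * trace X
      = (\<Sum>i\<in>UNIV. 2 * x $ i * ?b i - ?\<delta> * X $ i $ i)"
    by (simp add: inner_matrix_vector_mult trace_def sum_subtractf sum_distrib_left mult.assoc)
  also have "\<dots> \<le> (\<Sum>i\<in>UNIV. ?L\<^sup>2 / ?\<delta> * (t i * ?c i))"
    by (intro sum_mono summand)
  also have "\<dots> = ?L\<^sup>2 / ?\<delta> * (\<Sum>i\<in>UNIV. t i * ?c i)"
    by (rule sum_distrib_left[symmetric])
  also have "\<dots> \<le> ?L\<^sup>2 / ?\<delta> * (tau A k * ((norm y)\<^sup>2 - r))"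
    using pos top sum_correlations_le_explained[OF nz k eq_imp_le[OF S] r]
    by (intro mult_left_mono) auto
  also have "\<dots> = tau A k * eta A \<alpha> * ((norm y)\<^sup>2 - r)" by (simp add: eta_def)
  finally have "2 * (y \<bullet> (A *v x)) - ?\<delta> * trace X \<le> tau A k * eta A \<alpha> * ((norm y)\<^sup>2 - r)" .
  \<comment> \<open>Both \<open>A^T A - \<lambda> I\<close> and \<open>X\<close> are positive
    semidefinite, so their inner product is nonnegative.\<close>
  moreover have "lambda_min (transpose A ** A) * trace X \<le> mat_inner (transpose A ** A) X"
  proof -
    have "psd X" using X by (simp add: S_nk_def loewner_ge_def)
    then show ?thesis
      using mat_inner_psd_nonneg[OF psd_diff_lambda_min[OF symmetric_gram]]
      by (simp add: mat_inner_diff_left mat_inner_scaleR_left mat_inner_mat_1)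
  qed
  ultimately show ?thesis
    by (simp add: mat_inner_cost_bordered distrib_left distrib_right)
qed

section \<open>Rank-one lifts of sparse vectors\<close>

lemma quad_form_rank_one: "v \<bullet> ((\<chi> i j. x $ i * x $ j) *v v) = (x \<bullet> v)\<^sup>2"
  for x :: "real^'n"
proof -
  have "(x \<bullet> v)\<^sup>2 = (\<Sum>i\<in>UNIV. \<Sum>j\<in>UNIV. (x $ i * v $ i) * (x $ j * v $ j))"
    by (simp add: inner_vec_def power2_eq_square sum_product)
  then show ?thesis by (simp add: quad_form_sum mult_ac)
qed

text \<open>Cauchy-Schwarz on the support of \<open>x\<close>, which has at most \<open>k\<close>
  elements, shows that \<open>x x^T\<close> is dominated by \<open>k\<close> times its
  diagonal.\<close>

lemma Q_feasible_rank_one: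
  fixes x :: "real^'n"
  assumes "l0_norm x \<le> k"
  shows "bordered 1 x (\<chi> i j. x $ i * x $ j) \<in> Q_feasible k"
proof -
  let ?X = "\<chi> i j. x $ i * x $ j"
  have sym: "symmetric_mat ?X"
    by (simp add: symmetric_mat_def transpose_def vec_eq_iff mult.commute)
  have "(x \<bullet> v)\<^sup>2 \<le> real k * (\<Sum>i\<in>UNIV. (x $ i * x $ i) * (v $ i)\<^sup>2)" for v
  proof -
    let ?S = "{i. x $ i \<noteq> 0}"
    have "x \<bullet> v = (\<Sum>i\<in>?S. 1 * (x $ i * v $ i))"
      unfolding inner_vec_def by (rule sum.mono_neutral_cong_right) auto
    then have "(x \<bullet> v)\<^sup>2 \<le> (\<Sum>i\<in>?S. 1\<^sup>2) * (\<Sum>i\<in>?S. (x $ i * v $ i)\<^sup>2)"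
      using Cauchy_Schwarz_ineq_sum[of "\<lambda>_. 1" "\<lambda>i. x $ i * v $ i" ?S] by simp
    also have "\<dots> = real (l0_norm x) * (\<Sum>i\<in>UNIV. (x $ i * x $ i) * (v $ i)\<^sup>2)"
    proof -
      have "(\<Sum>i\<in>?S. (x $ i * v $ i)\<^sup>2) = (\<Sum>i\<in>UNIV. (x $ i * x $ i) * (v $ i)\<^sup>2)"
        by (rule sum.mono_neutral_cong_left) (auto simp: power2_eq_square)
      then show ?thesis by (simp add: l0_norm_def)
    qed
    also have "\<dots> \<le> real k * (\<Sum>i\<in>UNIV. (x $ i * x $ i) * (v $ i)\<^sup>2)"
      using assms by (intro mult_right_mono sum_nonneg) auto
    finally show ?thesis .
  qed
  moreover have "symmetric_mat (real k *\<^sub>R diag_mat ?X - ?X)"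
    by (simp add: symmetric_mat_def transpose_def vec_eq_iff diag_mat_def mult.commute)
  ultimately have "psd (real k *\<^sub>R diag_mat ?X - ?X)"
    by (simp add: psd_def matrix_vector_mult_diff_rdistrib inner_diff_right quad_form_diag_mat
        quad_form_rank_one flip: scaleR_matrix_vector_assoc)
  moreover have "psd ?X" using sym by (simp add: psd_def quad_form_rank_one)
  moreover have "psd (bordered 1 x ?X)"
  proof -
    have "0 \<le> s\<^sup>2 + 2 * s * p + p\<^sup>2" for s p :: real
      using zero_le_power2[of "s + p"] by (simp add: power2_sum algebra_simps)
    then show ?thesis
      using symmetric_bordered[OF sym] by (simp add: psd_def quad_form_bordered quad_form_rank_one)
  qed
  ultimately show ?thesis
    using sym by (auto simp: Q_feasible_def S_nk_def loewner_ge_def)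
qed

text \<open>Lifting preserves the objective, so every value of the sparse problem is a value of the
  relaxation; hence \<open>rho_bar\<close> is at most \<open>rho\<close>.\<close>

lemma mat_inner_cost_rank_one:
  "mat_inner (cost_mat A y \<alpha>) (bordered 1 x (\<chi> i j. x $ i * x $ j)) = ridge_obj A y \<alpha> x"
  for A :: "real^'n^'m"
proof -
  have "mat_inner (transpose A ** A) (\<chi> i j. x $ i * x $ j) = x \<bullet> ((transpose A ** A) *v x)"
    by (simp add: mat_inner_sum quad_form_sum mult_ac)
  then have gram: "mat_inner (transpose A ** A) (\<chi> i j. x $ i * x $ j) = (norm (A *v x))\<^sup>2"
    by (simp add: quad_form_gram)
  have trace: "trace (\<chi> i j. x $ i * x $ j) = (norm x)\<^sup>2"
    unfolding power2_norm_eq_inner by (simp add: trace_def inner_vec_def)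
  have "(norm (A *v x - y))\<^sup>2 = (norm y)\<^sup>2 - 2 * (y \<bullet> (A *v x)) + (norm (A *v x))\<^sup>2"
    unfolding power2_norm_eq_inner
    by (simp add: inner_diff_left inner_diff_right inner_commute[of "A *v x" y])
  then show ?thesis
    unfolding mat_inner_cost_bordered gram trace ridge_obj_def by simp
qed

lemma Q_feasible_nonempty: "Q_feasible k \<noteq> {}"
  using Q_feasible_rank_one[of 0 k] by (auto simp: l0_norm_def)

section \<open>The two bounds and the gap at \<open>alpha_bar\<close>\<close>

theorem theorem5p2:
  fixes A :: "real^'n^'m" and y :: "real^'m" and x0 :: "real^'n" and k :: nat and r0 :: real
  assumes "\<And>j. column j A \<noteq> 0"
    and "1 \<le> k" and "k \<le> CARD('n)"
    and "is_arg_min (ridge_obj A y 0) (\<lambda>x. l0_norm x \<le> k) x0"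
    and "r0 = 1 / real CARD('m) * (norm (y - A *v x0))\<^sup>2"
  shows "(\<forall>\<alpha>\<ge>0. lambda_min (transpose A ** A) + real CARD('m) * \<alpha> > 0 \<longrightarrow>
            (1 - tau A k * eta A \<alpha>) * ((norm y)\<^sup>2 / real CARD('m)) + tau A k * eta A \<alpha> * r0
              \<le> rho_bar A y k \<alpha>
            \<and> rho_bar A y k \<alpha> \<le> rho A y k \<alpha>)
       \<and> (0 \<le> alpha_bar A k
          \<and> lambda_min (transpose A ** A) + real CARD('m) * alpha_bar A k > 0
          \<and> tau A k * eta A (alpha_bar A k) = 1)
       \<and> (0 \<le> rho A y k (alpha_bar A k) - rho_bar A y k (alpha_bar A k)
          \<and> rho A y k (alpha_bar A k) - rho_bar A y k (alpha_bar A k)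
              \<le> tau A k * ((max_column_norm A)\<^sup>2 / real CARD('m)) * (norm x0)\<^sup>2
          \<and> tau A k * ((max_column_norm A)\<^sup>2 / real CARD('m)) * (norm x0)\<^sup>2
              \<le> real k * ((max_column_norm A)\<^sup>2 / real CARD('m)) * (norm x0)\<^sup>2)"
proof -
  let ?lmin = "lambda_min (transpose A ** A)" and ?m = "real CARD('m)"
  let ?L = "max_column_norm A" and ?\<tau> = "tau A k" and ?\<alpha> = "alpha_bar A k"
  let ?lower = "\<lambda>\<alpha>. (1 - ?\<tau> * eta A \<alpha>) * ((norm y)\<^sup>2 / ?m) + ?\<tau> * eta A \<alpha> * r0"
  note nz = assms(1) and k = assms(2,3)
  have m: "0 < ?m" by simp
  have x0: "l0_norm x0 \<le> k"
    and min: "\<And>x. l0_norm x \<le> k \<Longrightarrow> ridge_obj A y 0 x0 \<le> ridge_obj A y 0 x"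
    using assms(4) by (auto simp: is_arg_min_linorder)
  have r0: "?m * r0 \<le> (norm (y - A *v x))\<^sup>2" if "l0_norm x \<le> k" for x
    using min[OF that] m by (simp add: assms(5) ridge_obj_def norm_minus_commute divide_le_cancel)
  have lower: "?lower \<alpha> \<le> mat_inner (cost_mat A y \<alpha>) Z"
    if pos: "0 < ?lmin + ?m * \<alpha>" and feas: "Z \<in> Q_feasible k" for \<alpha> Z
  proof -
    obtain x X where X: "X \<in> S_nk k" and Z: "Z = bordered 1 x X" "psd Z"
      using feas by (auto simp: Q_feasible_def loewner_ge_def)
    have "?m * ?lower \<alpha> = (norm y)\<^sup>2 - ?\<tau> * eta A \<alpha> * ((norm y)\<^sup>2 - ?m * r0)"
      by (simp add: algebra_simps diff_divide_distrib)
    also have "\<dots> \<le> ?m * mat_inner (cost_mat A y \<alpha>) Z"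
      using explained_le_relaxation[OF nz k r0 pos X] Z by simp
    finally show ?thesis using m by simp
  qed
  have bounds: "?lower \<alpha> \<le> rho_bar A y k \<alpha> \<and> rho_bar A y k \<alpha> \<le> rho A y k \<alpha>"
    if pos: "0 < ?lmin + ?m * \<alpha>" for \<alpha>
  proof
    show "?lower \<alpha> \<le> rho_bar A y k \<alpha>"
      unfolding rho_bar_def using Q_feasible_nonempty[of k] lower[OF pos]
      by (intro cInf_greatest) auto
    have "bdd_below {mat_inner (cost_mat A y \<alpha>) Z | Z. Z \<in> Q_feasible k}"
      using lower[OF pos] by (intro bdd_belowI[of _ "?lower \<alpha>"]) blast
    moreover have "{ridge_obj A y \<alpha> x | x. l0_norm x \<le> k}
        \<subseteq> {mat_inner (cost_mat A y \<alpha>) Z | Z. Z \<in> Q_feasible k}"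
      using Q_feasible_rank_one by (auto simp flip: mat_inner_cost_rank_one)
    moreover have "{ridge_obj A y \<alpha> x | x. l0_norm x \<le> k} \<noteq> {}" using x0 by blast
    ultimately show "rho_bar A y k \<alpha> \<le> rho A y k \<alpha>"
      unfolding rho_bar_def rho_def by (intro cInf_superset_mono)
  qed
  have \<tau>: "1 \<le> ?\<tau>" "?\<tau> \<le> real k" using tau_bounds[OF nz k] by auto
  obtain j where j: "?L = norm (column j A)" using max_column_norm_attained by blast
  then have L: "0 < ?L" using nz by simp
  \<comment> \<open>\<open>alpha_bar\<close> is chosen so that the denominator of \<open>eta\<close>
    becomes \<tau> times its numerator.\<close>
  have m\<alpha>: "?lmin + ?m * ?\<alpha> = ?\<tau> * ?L\<^sup>2"
    by (simp add: alpha_bar_def algebra_simps)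
  have pos: "0 < ?lmin + ?m * ?\<alpha>" unfolding m\<alpha> using \<tau> L by simp
  have "?lmin \<le> ?L\<^sup>2" using lambda_min_gram_le[of A j] j by simp
  also have "\<dots> \<le> ?\<tau> * ?L\<^sup>2" using \<tau> by (simp add: mult_le_cancel_right1)
  finally have "0 \<le> ?m * ?\<alpha>" using m\<alpha> by simp
  then have \<alpha>: "0 \<le> ?\<alpha>" using m by (simp add: zero_le_mult_iff)
  have \<tau>\<eta>: "?\<tau> * eta A ?\<alpha> = 1" using \<tau> L by (simp add: eta_def m\<alpha>)
  have "rho A y k ?\<alpha> \<le> ridge_obj A y ?\<alpha> x0"
    unfolding rho_def using x0 \<alpha>
    by (intro cInf_lower bdd_belowI[of _ 0]) (auto simp: ridge_obj_def)
  also have "\<dots> = r0 + ?\<alpha> * (norm x0)\<^sup>2"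
    by (simp add: ridge_obj_def assms(5) norm_minus_commute)
  \<comment> \<open>Since \<tau> \<eta> = 1, the term in \<open>norm y\<close> vanishes and the
    lower bound on \<open>rho_bar\<close> reduces to \<open>r0\<close>.\<close>
  also have "\<dots> \<le> rho_bar A y k ?\<alpha> + ?\<alpha> * (norm x0)\<^sup>2"
    using bounds[OF pos] by (simp add: \<tau>\<eta>)
  finally have "rho A y k ?\<alpha> - rho_bar A y k ?\<alpha> \<le> ?\<alpha> * (norm x0)\<^sup>2" by simp
  \<comment> \<open>The smallest eigenvalue enters \<open>alpha_bar\<close> with a minus sign and is
    nonnegative, so dropping it only enlarges the bound.\<close>
  also have "\<dots> \<le> ?\<tau> * (?L\<^sup>2 / ?m) * (norm x0)\<^sup>2"
    using lambda_min_gram_nonneg[of A] by (intro mult_right_mono) (auto simp: alpha_bar_def)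
  finally have gap: "rho A y k ?\<alpha> - rho_bar A y k ?\<alpha> \<le> ?\<tau> * (?L\<^sup>2 / ?m) * (norm x0)\<^sup>2" .
  have "?\<tau> * (?L\<^sup>2 / ?m) * (norm x0)\<^sup>2 \<le> real k * (?L\<^sup>2 / ?m) * (norm x0)\<^sup>2"
    using \<tau> by (intro mult_right_mono) auto
  then show ?thesis using bounds pos \<alpha> \<tau>\<eta> gap by auto
qed

end
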